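(* Let $x$ be a positive integer and let $G$ be a complete graph on $x$ vertices. If bicliques $B_1, \dots, B_c$, each a subgraph of $G$, edge-cover $G$, then the sum of their sizes satisfies $$\sum_{i=1}^{c} |B_i| \ge x\log_2 x.$$
   Context: A biclique $K_{a,b}$ is a graph whose vertex set is partitioned into two sets, of $a$ and $b$ vertices respectively, such that every vertex of the first set is adjacent to every vertex of the second set and no two vertices in the same set are adjacent. The size of a biclique $B = K_{a,b}$ is $|B| = a+b$, its number of vertices. A family of bicliques that are (not necessarily induced) subgraphs of $G$ edge-covers $G$ if every edge of $G$ belongs to at least one biclique in the family; bicliques in the family may share edges. *)

theory Defs
  imports Complex_Main "Graph_Theory.Kuratowski"
begin

text \<open>
  As in the Graph_Theory entry, an undirected simple graph is a symmetric digraph, so that an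
  edge is represented by its two opposite arcs. A side of a biclique may be empty.
\<close>

definition biclique :: "('a, 'b) pre_digraph \<Rightarrow> bool" where
  "biclique B \<longleftrightarrow> (\<exists>a b. K\<^bsub>a,b\<^esub> B)"

definition graph_size :: "('a, 'b) pre_digraph \<Rightarrow> nat" where
  "graph_size B = card (verts B)"

lemma graph_size_biclique:
  assumes "K\<^bsub>a,b\<^esub> B"
  shows "graph_size B = a + b"
proof -
  from assms interpret graph B by (simp add: complete_bipartite_digraph_def)
  from assms obtain U V where "verts B = U \<union> V" "U \<inter> V = {}" "card U = a" "card V = b"
    by (auto simp: complete_bipartite_digraph_def)
  moreover from this finite_verts have "finite U" "finite V" by auto
  ultimately show ?thesis by (simp add: graph_size_def card_Un_disjoint)
qed

text \<open>
  Arcs may be compared directly, since subgraphs share the arc type and the incidence functions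
  of \<open>G\<close>. For simple \<open>G\<close>, a symmetric subgraph contains an arc iff it contains the opposite arc,
  so covering all arcs amounts to covering all undirected edges.
\<close>

definition edge_covers ::
    "'i set \<Rightarrow> ('i \<Rightarrow> ('a, 'b) pre_digraph) \<Rightarrow> ('a, 'b) pre_digraph \<Rightarrow> bool" where
  "edge_covers I B G \<longleftrightarrow> (\<forall>e \<in> arcs G. \<exists>i \<in> I. e \<in> arcs (B i))"

end

theory Submission
  imports Defs
begin

text \<open>
  Let each biclique delete one of its two sides, chosen by a fair coin, from the vertex set. A vertex
  that lies in \<open>d v\<close> of the bicliques survives with probability \<open>2 ^ - d v\<close>. At most one vertex
  survives, since any two vertices are on opposite sides of some biclique, so
  \<open>\<Sum>v. 2 ^ - d v \<le> 1\<close>, as in Kraft's inequality. By the concavity of the logarithm,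
  \<open>\<Sum>v. d v \<ge> x log\<^sub>2 x\<close>, and the left-hand side is the sum of the sizes of the bicliques.
\<close>

text \<open>The induction on \<open>I\<close> tosses one coin at a time: the weighted sum for
  \<open>insert j I\<close> is the average of the sums for \<open>I\<close> over the two vertex sets
  that the coin of \<open>j\<close> can leave. Hence \<open>A\<close> has to vary.\<close>

lemma kraft_separating_pairs:
  fixes U V :: "'i \<Rightarrow> 'a set"
  assumes "finite I" "finite A"
    and "\<And>i. i \<in> I \<Longrightarrow> U i \<inter> V i = {}"
    and "\<And>u v. \<lbrakk>u \<in> A; v \<in> A; u \<noteq> v\<rbrakk> \<Longrightarrow> \<exists>i\<in>I. (u, v) \<in> U i \<times> V i \<union> V i \<times> U i"
  shows "(\<Sum>v\<in>A. (1/2::real) ^ card {i \<in> I. v \<in> U i \<union> V i}) \<le> 1"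
  using assms
proof (induction I arbitrary: A rule: finite_induct)
  case empty
  \<comment> \<open>Without indices no two vertices are separated, and a remaining vertex has weight
    1.\<close>
  then have "card A \<le> 1"
    by (auto simp: card_le_Suc0_iff_eq)
  then show ?case by simp
next
  case (insert j I)
  define f where "f v = (1/2::real) ^ card {i \<in> I. v \<in> U i \<union> V i}" for v
  define R where "R = A - (U j \<union> V j)"
  have UV: "U j \<inter> V j = {}"
    using insert.prems(2) by simp
  \<comment> \<open>A pair separated by \<open>j\<close> has a vertex on each side of
    \<open>j\<close>. Once one side is deleted, the remaining pairs are therefore separated by
    \<open>I\<close> alone.\<close>
  have "sum f (A - V j) \<le> 1" "sum f (A - U j) \<le> 1"
    unfolding f_def using insert.prems by (intro insert.IH; fastforce)+
  moreover have "sum f (A - V j) = sum f (A \<inter> U j) + sum f R"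
    unfolding R_def using \<open>finite A\<close> UV
    by (subst sum.union_disjoint[symmetric]) (auto intro!: sum.cong)
  moreover have "sum f (A - U j) = sum f (A \<inter> V j) + sum f R"
    unfolding R_def using \<open>finite A\<close> UV
    by (subst sum.union_disjoint[symmetric]) (auto intro!: sum.cong)
  \<comment> \<open>Vertices of \<open>U j\<close> and \<open>V j\<close> lose half their weight,
    and each of these sets occurs in only one of the two sums above; \<open>R\<close> occurs in
    both. So the new sum is their mean.\<close>
  moreover have "(\<Sum>v\<in>A. (1/2::real) ^ card {i \<in> insert j I. v \<in> U i \<union> V i})
      = (\<Sum>v\<in>A. if v \<in> U j \<union> V j then f v / 2 else f v)"
  proof (rule sum.cong)
    fix v assume "v \<in> A"
    have "{i \<in> insert j I. v \<in> U i \<union> V i} = (if v \<in> U j \<union> V j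
        then insert j {i \<in> I. v \<in> U i \<union> V i} else {i \<in> I. v \<in> U i \<union> V i})"
      by auto
    then show "(1/2::real) ^ card {i \<in> insert j I. v \<in> U i \<union> V i}
        = (if v \<in> U j \<union> V j then f v / 2 else f v)"
      using insert.hyps by (simp add: f_def)
  qed simp
  moreover have "\<dots> = sum f (A \<inter> (U j \<union> V j)) / 2 + sum f R"
    using \<open>finite A\<close> by (simp add: sum.If_cases R_def sum_divide_distrib Diff_eq del: Un_iff)
  moreover have "sum f (A \<inter> (U j \<union> V j)) = sum f (A \<inter> U j) + sum f (A \<inter> V j)"
    using \<open>finite A\<close> UV by (subst sum.union_disjoint[symmetric]) (auto intro!: sum.cong)
  ultimately show ?case by argo
qed

lemma kraft_sum_ge_log:
  fixes d :: "'a \<Rightarrow> nat"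
  assumes "finite A" "(\<Sum>v\<in>A. (1/2::real) ^ d v) \<le> 1"
  shows "(\<Sum>v\<in>A. real (d v)) \<ge> real (card A) * log 2 (real (card A))"
proof (cases "A = {}")
  case False
  define x where "x = real (card A)"
  have x: "x > 0"
    using False \<open>finite A\<close> by (simp add: x_def card_gt_0_iff)
  \<comment> \<open>Jensen's inequality is replaced by the tangent bound ln t \<le> t - 1 at t = x *
    (1/2) ^ d v. By the hypothesis, the mean of these t over \<open>A\<close> is at most 1, so the
    right-hand sides sum to at most 0.\<close>
  have "ln x - real (d v) * ln 2 \<le> x * (1/2) ^ d v - 1" for v
    using ln_le_minus_one[of "x * (1/2) ^ d v"] x
    by (simp add: ln_mult ln_realpow ln_div)
  then have "(\<Sum>v\<in>A. ln x - real (d v) * ln 2) \<le> (\<Sum>v\<in>A. x * (1/2) ^ d v - 1)"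
    by (intro sum_mono)
  also have "\<dots> = x * (\<Sum>v\<in>A. (1/2) ^ d v) - x"
    by (simp add: sum_subtractf sum_distrib_left x_def)
  also have "\<dots> \<le> 0"
    using assms(2) x mult_left_mono[of "\<Sum>v\<in>A. (1/2::real) ^ d v" 1 x] by simp
  finally have "x * ln x \<le> (\<Sum>v\<in>A. real (d v)) * ln 2"
    by (simp add: sum_subtractf sum_distrib_right x_def)
  then have "x * log 2 x \<le> (\<Sum>v\<in>A. real (d v))"
    by (simp add: log_def divide_le_eq)
  then show ?thesis by (simp add: x_def)
qed simp

theorem lemma2p2:
  fixes x c :: nat
    and G :: "('a, 'b) pre_digraph"
    and B :: "nat \<Rightarrow> ('a, 'b) pre_digraph"
  assumes "x > 0"
    and "K\<^bsub>x\<^esub> G"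
    and "\<And>i. i \<in> {1..c} \<Longrightarrow> biclique (B i)"
    and "\<And>i. i \<in> {1..c} \<Longrightarrow> subgraph (B i) G"
    and "edge_covers {1..c} B G"
  shows "(\<Sum>i = 1..c. real (graph_size (B i))) \<ge> real x * log 2 (real x)"
proof -
  let ?A = "verts G" and ?I = "{1..c}"
  \<comment> \<open>Finiteness follows from x > 0, since \<open>card\<close> is 0 on infinite
    sets.\<close>
  have A: "finite ?A" "card ?A = x"
    and ends: "arcs_ends G = {(u, v). (u, v) \<in> ?A \<times> ?A \<and> u \<noteq> v}"
    using assms(1,2) card_ge_0_finite by (auto simp: complete_digraph_def)
  have "\<forall>i\<in>?I. \<exists>U V. verts (B i) = U \<union> V \<and> U \<inter> V = {} \<and> arcs_ends (B i) = U \<times> V \<union> V \<times> U"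
    using assms(3) unfolding biclique_def complete_bipartite_digraph_def by metis
  then obtain U V where UV: "\<And>i. i \<in> ?I \<Longrightarrow> verts (B i) = U i \<union> V i"
      "\<And>i. i \<in> ?I \<Longrightarrow> U i \<inter> V i = {}"
      "\<And>i. i \<in> ?I \<Longrightarrow> arcs_ends (B i) = U i \<times> V i \<union> V i \<times> U i"
    by metis
  define d where "d v = card {i \<in> ?I. v \<in> U i \<union> V i}" for v
  have "\<exists>i\<in>?I. (u, v) \<in> U i \<times> V i \<union> V i \<times> U i" if "u \<in> ?A" "v \<in> ?A" "u \<noteq> v" for u v
  proof -
    have "(u, v) \<in> arcs_ends G"
      using that ends by simp
    then obtain e where e: "e \<in> arcs G" "arc_to_ends G e = (u, v)"
      by (auto simp: arcs_ends_def)
    then obtain i where i: "i \<in> ?I" "e \<in> arcs (B i)"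
      using assms(5) by (auto simp: edge_covers_def)
    \<comment> \<open>A subgraph shares tail and head maps with \<open>G\<close>, so the covering
      arc has the same ends in \<open>B i\<close>.\<close>
    then have "arc_to_ends (B i) e = (u, v)"
      using assms(4)[OF i(1)] e by (simp add: subgraph_def compatible_def arc_to_ends_def)
    then have "(u, v) \<in> arcs_ends (B i)"
      using i(2) unfolding arcs_ends_def by force
    then show ?thesis using UV(3) i(1) by blast
  qed
  then have "(\<Sum>v\<in>?A. (1/2::real) ^ d v) \<le> 1"
    unfolding d_def using A(1) UV(2) by (intro kraft_separating_pairs) auto
  then have "real x * log 2 (real x) \<le> (\<Sum>v\<in>?A. real (d v))"
    using kraft_sum_ge_log[of ?A d] A by simp
  \<comment> \<open>Double counting of the pairs of a vertex and a biclique containing it.\<close>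
  also have "(\<Sum>v\<in>?A. d v) = (\<Sum>i\<in>?I. card {v \<in> ?A. v \<in> U i \<union> V i})"
    unfolding d_def using A(1) by (intro sum_multicount_gen) auto
  then have "(\<Sum>v\<in>?A. real (d v)) = (\<Sum>i\<in>?I. real (card {v \<in> ?A. v \<in> U i \<union> V i}))"
    by (metis of_nat_sum)
  also have "\<dots> = (\<Sum>i\<in>?I. real (graph_size (B i)))"
  proof (rule sum.cong)
    fix i assume i: "i \<in> ?I"
    then have "{v \<in> ?A. v \<in> U i \<union> V i} = verts (B i)"
      using assms(4)[OF i] UV(1)[OF i] by (auto simp: subgraph_def)
    then show "real (card {v \<in> ?A. v \<in> U i \<union> V i}) = real (graph_size (B i))"
      by (simp add: graph_size_def)
  qed simp
  finally show ?thesis .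
qed

end
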